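(* Let $S$ be the unique formal power series in the variables $t_1,t_2,\dots$ satisfying $S=1+\sum_{n=1}^\infty t_nS^n$. Then $S$ is the generating function for excursions, i.e. $S=\sum_{P}w(P)$, where the sum is over all excursions $P$ with steps in $\{-1,0,1,2,\dots\}$ and $w(P)$ is the weight of $P$.
   Context: A path is a finite (possibly empty) sequence $(s_1,\dots,s_k)$ of integers, called its steps; here all steps are in $\{-1,0,1,2,\dots\}$. An excursion is a path (possibly empty) such that every partial sum $s_1+\cdots+s_i$ ($0\le i\le k$) is nonnegative and the total sum $s_1+\cdots+s_k$ is $0$. The weight of a step $n\ge 0$ is $t_{n+1}$, the weight of the step $-1$ is $1$, and the weight $w(P)$ of a path $P$ is the product of the weights of its steps (the empty path has weight $1$). The generating function for a set of paths is the sum of their weights, as a formal power series in the infinitely many commuting variables $t_1,t_2,\dots$ (arbitrary formal, possibly infinite, linear combinations of monomials). *)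

theory Defs
  imports "HOL-Library.Multiset"
begin

text \<open>
  Formal power series over an arbitrary (possibly infinite) set of commuting variables. A monomial
  is the finite multiset of its variables, e.g. \<open>{#x, x, y#}\<close> stands for \<open>x\<^sup>2 y\<close>, and a series is an
  arbitrary assignment of coefficients to monomials.
\<close>

typedef ('v, 'a) mfps = "UNIV :: ('v multiset \<Rightarrow> 'a) set"
  morphisms coeff Abs_mfps ..

lemma coeff_Abs_mfps [simp]: "coeff (Abs_mfps f) = f"
  by (simp add: Abs_mfps_inverse)

lemma mfps_eqI: "(\<And>m. coeff f m = coeff g m) \<Longrightarrow> f = g"
  by (simp add: coeff_inject[symmetric] fun_eq_iff)

lemma finite_submultisets: "finite {a. a \<subseteq># m}"
proof (induction m)
  case (add x m)
  have "{a. a \<subseteq># add_mset x m} \<subseteq> {a. a \<subseteq># m} \<union> add_mset x ` {a. a \<subseteq># m}"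
  proof
    fix a assume a: "a \<in> {a. a \<subseteq># add_mset x m}"
    show "a \<in> {a. a \<subseteq># m} \<union> add_mset x ` {a. a \<subseteq># m}"
    proof (cases "x \<in># a")
      case True
      then obtain b where "a = add_mset x b" by (meson multi_member_split)
      with a show ?thesis by auto
    next
      case False
      with a show ?thesis
        by (auto simp: subseteq_mset_def count_eq_zero_iff[symmetric] split: if_splits)
          (metis le0 count_inI)
    qed
  qed
  then show ?case using add.IH by (meson finite_UnI finite_imageI finite_subset)
qed simp

lemma finite_splits [simp]: "finite {(a, b). a + b = (m :: 'v multiset)}"
proof (rule finite_subset)
  show "{(a, b). a + b = m} \<subseteq> {a. a \<subseteq># m} \<times> {a. a \<subseteq># m}" by auto
qed (simp add: finite_submultisets)

instantiation mfps :: (type, comm_ring_1) comm_ring_1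
begin

definition zero_mfps_def: "0 = Abs_mfps (\<lambda>_. 0)"

definition one_mfps_def: "1 = Abs_mfps (\<lambda>m. if m = {#} then 1 else 0)"

definition plus_mfps_def: "f + g = Abs_mfps (\<lambda>m. coeff f m + coeff g m)"

definition uminus_mfps_def: "- f = Abs_mfps (\<lambda>m. - coeff f m)"

definition minus_mfps_def: "f - g = Abs_mfps (\<lambda>m. coeff f m - coeff g m)"

definition times_mfps_def:
  "f * g = Abs_mfps (\<lambda>m. \<Sum>(a, b) \<in> {(a, b). a + b = m}. coeff f a * coeff g b)"

instance
proof
  fix f g h :: "('a, 'b) mfps"
  show "f * g * h = f * (g * h)"
  proof (rule mfps_eqI)
    fix m :: "'a multiset"
    have "coeff (f * g * h) m = (\<Sum>p \<in> {(a, b). a + b = m}. \<Sum>q \<in> {(c, d). c + d = fst p}.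
        coeff f (fst q) * coeff g (snd q) * coeff h (snd p))"
      by (simp add: times_mfps_def case_prod_unfold sum_distrib_right)
    also have "\<dots> = (\<Sum>(p, q) \<in> (SIGMA p:{(a, b). a + b = m}. {(c, d). c + d = fst p}).
        coeff f (fst q) * coeff g (snd q) * coeff h (snd p))"
      by (rule sum.Sigma) auto
    also have "\<dots> = (\<Sum>(p, q) \<in> (SIGMA p:{(a, b). a + b = m}. {(c, d). c + d = snd p}).
        coeff f (fst p) * (coeff g (fst q) * coeff h (snd q)))"
      by (rule sum.reindex_bij_witness
          [where i = "\<lambda>((a, b), (c, d)). ((a + c, d), (a, c))"
             and j = "\<lambda>((a, b), (c, d)). ((c, d + b), (d, b))"])
         (auto simp: ac_simps)
    also have "\<dots> = (\<Sum>p \<in> {(a, b). a + b = m}. \<Sum>q \<in> {(c, d). c + d = snd p}.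
        coeff f (fst p) * (coeff g (fst q) * coeff h (snd q)))"
      by (rule sum.Sigma[symmetric]) auto
    also have "\<dots> = coeff (f * (g * h)) m"
      by (simp add: times_mfps_def case_prod_unfold sum_distrib_left)
    finally show "coeff (f * g * h) m = coeff (f * (g * h)) m" .
  qed
  show "f * g = g * f"
    unfolding times_mfps_def
    by (intro arg_cong[where f = Abs_mfps] ext
          sum.reindex_bij_witness[where i = prod.swap and j = prod.swap])
       (auto simp: ac_simps)
  show "1 * f = f"
  proof (rule mfps_eqI)
    fix m :: "'a multiset"
    have "coeff (1 * f) m = (\<Sum>(a, b) \<in> {({#} :: 'a multiset, m)}. (if a = {#} then 1 else 0) * coeff f b)"
      unfolding times_mfps_def one_mfps_def coeff_Abs_mfps
      by (rule sum.mono_neutral_right) (auto split: if_splits)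
    then show "coeff (1 * f) m = coeff f m" by simp
  qed
  show "(f + g) * h = f * h + g * h"
    by (simp add: times_mfps_def plus_mfps_def case_prod_unfold distrib_right sum.distrib)
  have "coeff (0 :: ('a, 'b) mfps) {#} \<noteq> coeff 1 {#}"
    by (simp add: zero_mfps_def one_mfps_def)
  then show "(0 :: ('a, 'b) mfps) \<noteq> 1" by metis
qed (auto simp: zero_mfps_def plus_mfps_def uminus_mfps_def minus_mfps_def ac_simps
       coeff_inverse)

end

definition mfps_var :: "'v \<Rightarrow> ('v, 'a :: comm_ring_1) mfps" where
  "mfps_var v = Abs_mfps (\<lambda>m. if m = {#v#} then 1 else 0)"

text \<open>
  A formal infinite sum is meaningful if every monomial occurs in only finitely many summands. The
  value of \<open>mfps_sum f I\<close> is only meaningful together with \<open>mfps_summable f I\<close>.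
\<close>

definition mfps_summable :: "('i \<Rightarrow> ('v, 'a :: comm_ring_1) mfps) \<Rightarrow> 'i set \<Rightarrow> bool" where
  "mfps_summable f I \<longleftrightarrow> (\<forall>m. finite {i \<in> I. coeff (f i) m \<noteq> 0})"

definition mfps_sum :: "('i \<Rightarrow> ('v, 'a :: comm_ring_1) mfps) \<Rightarrow> 'i set \<Rightarrow> ('v, 'a) mfps" where
  "mfps_sum f I = Abs_mfps (\<lambda>m. \<Sum>i \<in> {i \<in> I. coeff (f i) m \<noteq> 0}. coeff (f i) m)"

text \<open>
  The variables \<open>t\<^sub>1, t\<^sub>2, \<dots>\<close> are numbered from \<open>1\<close>, so \<open>t\<^sub>n\<close> is the variable with index \<open>n - 1\<close> of the
  variable type \<^typ>\<open>nat\<close>. The term \<open>t 0\<close> is a junk value.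
\<close>

definition t :: "nat \<Rightarrow> (nat, 'a :: comm_ring_1) mfps" where
  "t n = mfps_var (n - 1)"

definition tree_equation :: "(nat, 'a :: comm_ring_1) mfps \<Rightarrow> bool" where
  "tree_equation S \<longleftrightarrow>
     mfps_summable (\<lambda>n. t n * S ^ n) {1..} \<and> S = 1 + mfps_sum (\<lambda>n. t n * S ^ n) {1..}"

definition excursions :: "int list set" where
  "excursions = {P. set P \<subseteq> {-1..} \<and> (\<forall>i \<le> length P. 0 \<le> sum_list (take i P)) \<and> sum_list P = 0}"

text \<open>Only used for steps \<open>s \<ge> -1\<close>.\<close>

definition step_weight :: "int \<Rightarrow> (nat, 'a :: comm_ring_1) mfps" where
  "step_weight s = (if s = -1 then 1 else t (nat s + 1))"

definition path_weight :: "int list \<Rightarrow> (nat, 'a :: comm_ring_1) mfps" where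
  "path_weight P = prod_list (map step_weight P)"

end

(* Let A 0 = 1 and let A (k + 1) be the generating function of the nonnegative paths from height k
   to height 0. Splitting off the first step gives
     A (k + 1) = A k + (\<Sum>v. t (v + 1) * A (k + 1 + v)),
   a linear recursion that determines A from A 0, by induction on the degree and then on k. If S
   solves the tree equation, then the powers S ^ k satisfy the same recursion, so S = A 1. Conversely,
   the families A (k + 1) and A k * A 1 satisfy the recursion with the same initial value, so
   A k = A 1 ^ k and the recursion at k = 0 is the tree equation for A 1. *)
theory Submission
  imports Defs
begin

section \<open>Coefficients of products and of sums weighted by the variables\<close>

lemma coeff_add [simp]: "coeff (f + g) m = coeff f m + coeff g m"
  by (simp add: plus_mfps_def)

lemma coeff_one: "coeff 1 m = (if m = {#} then 1 else 0)"
  by (simp add: one_mfps_def)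

lemma coeff_mult: "coeff (f * g) m = (\<Sum>(a, b) \<in> {(a, b). a + b = m}. coeff f a * coeff g b)"
  by (simp add: times_mfps_def)

lemma coeff_var_mult:
  "coeff (mfps_var v * f) m = (if v \<in># m then coeff f (m - {#v#}) else 0)"
proof -
  have "coeff (mfps_var v * f) m =
      (\<Sum>(a, b) \<in> (if v \<in># m then {({#v#}, m - {#v#})} else {}). coeff f b)"
    unfolding coeff_mult mfps_var_def coeff_Abs_mfps
    by (rule sum.mono_neutral_cong_right) (auto split: if_splits)
  then show ?thesis by simp
qed

text \<open>The coefficients of \<open>\<Sum>v. t (v + 1) * A v\<close>.\<close>

definition var_comb :: "('v \<Rightarrow> ('v, 'a :: comm_ring_1) mfps) \<Rightarrow> ('v, 'a) mfps" where
  "var_comb A = Abs_mfps (\<lambda>m. \<Sum>v \<in> set_mset m. coeff (A v) (m - {#v#}))"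

lemma coeff_var_comb: "coeff (var_comb A) m = (\<Sum>v \<in> set_mset m. coeff (A v) (m - {#v#}))"
  by (simp add: var_comb_def)

text \<open>Both coefficients at \<open>m\<close> sum over splittings of \<open>m\<close> with a
  marked variable \<open>v\<close> in the left part: taking out \<open>v\<close> after or before the
  splitting gives the two double sums.\<close>

lemma var_comb_mult_right: "var_comb A * f = var_comb (\<lambda>v. A v * f)"
proof (rule mfps_eqI)
  fix m
  have "coeff (var_comb A * f) m = (\<Sum>p \<in> {(a, b). a + b = m}. \<Sum>v \<in> set_mset (fst p).
      coeff (A v) (fst p - {#v#}) * coeff f (snd p))"
    by (simp add: coeff_mult coeff_var_comb case_prod_unfold sum_distrib_right)
  also have "\<dots> = (\<Sum>(p, v) \<in> (SIGMA p:{(a, b). a + b = m}. set_mset (fst p)).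
      coeff (A v) (fst p - {#v#}) * coeff f (snd p))"
    by (rule sum.Sigma) auto
  also have "\<dots> = (\<Sum>(v, p) \<in> (SIGMA v:set_mset m. {(a, b). a + b = m - {#v#}}).
      coeff (A v) (fst p) * coeff f (snd p))"
    by (rule sum.reindex_bij_witness
        [where i = "\<lambda>(v, (a, b)). ((add_mset v a, b), v)"
           and j = "\<lambda>((a, b), v). (v, (a - {#v#}, b))"])
       auto
  also have "\<dots> = (\<Sum>v \<in> set_mset m. \<Sum>p \<in> {(a, b). a + b = m - {#v#}}.
      coeff (A v) (fst p) * coeff f (snd p))"
    by (rule sum.Sigma [symmetric]) auto
  also have "\<dots> = coeff (var_comb (\<lambda>v. A v * f)) m"
    by (simp add: coeff_var_comb coeff_mult case_prod_unfold)
  finally show "coeff (var_comb A * f) m = coeff (var_comb (\<lambda>v. A v * f)) m" .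
qed

text \<open>Each monomial of \<open>t n * f n\<close> contains the variable with index
  \<open>n - 1\<close>, so \<open>m\<close> can occur only for \<open>n = Suc v\<close> with
  \<open>v\<close> in \<open>m\<close>, which leaves finitely many summands.\<close>

lemma
  shows mfps_summable_t_mult: "mfps_summable (\<lambda>n. t n * f n) {1..}" (is ?summable)
    and mfps_sum_t_mult: "mfps_sum (\<lambda>n. t n * f n) {1..} = var_comb (\<lambda>v. f (Suc v))" (is ?sum)
proof -
  have supp: "{n \<in> {1..}. coeff (t n * f n) m \<noteq> 0} \<subseteq> Suc ` set_mset m" for m
  proof
    fix n assume "n \<in> {n \<in> {1..}. coeff (t n * f n) m \<noteq> 0}"
    then have "n = Suc (n - 1)" "n - 1 \<in># m"
      by (auto simp: t_def coeff_var_mult split: if_splits)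
    then show "n \<in> Suc ` set_mset m" by blast
  qed
  show ?summable
    unfolding mfps_summable_def using finite_subset [OF supp] by blast
  show ?sum
  proof (rule mfps_eqI)
    fix m
    have "coeff (mfps_sum (\<lambda>n. t n * f n) {1..}) m = (\<Sum>n \<in> Suc ` set_mset m. coeff (t n * f n) m)"
      unfolding mfps_sum_def coeff_Abs_mfps
      by (rule sum.mono_neutral_left [OF _ supp]) auto
    also have "\<dots> = coeff (var_comb (\<lambda>v. f (Suc v))) m"
      by (simp add: sum.reindex coeff_var_comb t_def coeff_var_mult)
    finally show "coeff (mfps_sum (\<lambda>n. t n * f n) {1..}) m = coeff (var_comb (\<lambda>v. f (Suc v))) m" .
  qed
qed

lemma tree_equation_iff: "tree_equation S \<longleftrightarrow> S = 1 + var_comb (\<lambda>v. S ^ Suc v)"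
  by (simp only: tree_equation_def mfps_summable_t_mult mfps_sum_t_mult simp_thms)

section \<open>The linear first-step recursion and its solutions\<close>

definition first_step_rec :: "(nat \<Rightarrow> (nat, 'a :: comm_ring_1) mfps) \<Rightarrow> bool" where
  "first_step_rec A \<longleftrightarrow> (\<forall>k. A (Suc k) = A k + var_comb (\<lambda>v. A (Suc (k + v))))"

text \<open>Removing a variable lowers the degree, so the outer induction covers the
  \<open>var_comb\<close> terms although their index does not drop. The remaining term has the same
  degree but a smaller index, which the inner induction handles.\<close>

lemma first_step_rec_unique:
  assumes "first_step_rec A" "first_step_rec B" "A 0 = B 0"
  shows "A k = B k"
proof (rule mfps_eqI)
  fix m
  show "coeff (A k) m = coeff (B k) m"
  proof (induction "size m" arbitrary: m k rule: less_induct)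
    case less
    note smaller = less
    show ?case
    proof (induction k)
      case (Suc k)
      have "coeff (A (Suc (k + v))) (m - {#v#}) = coeff (B (Suc (k + v))) (m - {#v#})"
        if "v \<in># m" for v
        using smaller that by (simp add: size_Diff1_less)
      then have "coeff (var_comb (\<lambda>v. A (Suc (k + v)))) m = coeff (var_comb (\<lambda>v. B (Suc (k + v)))) m"
        by (simp add: coeff_var_comb)
      moreover have "A (Suc k) = A k + var_comb (\<lambda>v. A (Suc (k + v)))"
        "B (Suc k) = B k + var_comb (\<lambda>v. B (Suc (k + v)))"
        by (rule assms(1,2) [unfolded first_step_rec_def, rule_format])+
      ultimately show ?case
        using Suc.IH by (simp only: coeff_add)
    qed (simp add: assms)
  qed
qed

lemma first_step_rec_mult_right:
  assumes "first_step_rec A"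
  shows "first_step_rec (\<lambda>k. A k * f)"
  unfolding first_step_rec_def
proof
  fix k
  have "A (Suc k) * f = (A k + var_comb (\<lambda>v. A (Suc (k + v)))) * f"
    by (rule arg_cong [OF assms [unfolded first_step_rec_def, rule_format]])
  then show "A (Suc k) * f = A k * f + var_comb (\<lambda>v. A (Suc (k + v)) * f)"
    by (simp only: distrib_right var_comb_mult_right)
qed

text \<open>The recursion is invariant under shifts of the index.\<close>

lemma first_step_rec_Suc:
  assumes "first_step_rec A"
  shows "first_step_rec (\<lambda>k. A (Suc k))"
  unfolding first_step_rec_def
proof
  fix k
  show "A (Suc (Suc k)) = A (Suc k) + var_comb (\<lambda>v. A (Suc (Suc (k + v))))"
    using assms [unfolded first_step_rec_def, rule_format, of "Suc k"] by (simp only: add_Suc)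
qed

lemma first_step_rec_eq_power:
  assumes "first_step_rec A" "A 0 = 1"
  shows "A k = A 1 ^ k"
proof (induction k)
  case (Suc k)
  have "A (Suc k) = A k * A 1"
    by (rule first_step_rec_unique [OF first_step_rec_Suc first_step_rec_mult_right])
       (simp_all add: assms)
  then show ?case by (simp add: Suc.IH mult.commute)
qed (simp add: assms)

lemma tree_equation_first_step_rec:
  assumes "first_step_rec A" "A 0 = 1"
  shows "tree_equation (A 1)"
proof -
  have "A 1 = 1 + var_comb (\<lambda>v. A (Suc v))"
    using assms(1) [unfolded first_step_rec_def, rule_format, of 0]
    by (simp only: assms(2) One_nat_def add_0)
  then show ?thesis
    \<comment> \<open>The powers \<open>A 1 ^ Suc v\<close> in the tree equation are folded back
      into \<open>A (Suc v)\<close>.\<close>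
    unfolding tree_equation_iff first_step_rec_eq_power [OF assms, symmetric] .
qed

text \<open>Multiply the tree equation by \<open>S ^ k\<close> and move this factor into
  \<open>var_comb\<close>.\<close>

lemma first_step_rec_powers:
  assumes "tree_equation S"
  shows "first_step_rec (\<lambda>k. S ^ k)"
  unfolding first_step_rec_def
proof
  fix k
  have "S * S ^ k = (1 + var_comb (\<lambda>v. S ^ Suc v)) * S ^ k"
    by (rule arg_cong [OF assms [unfolded tree_equation_iff]])
  also have "\<dots> = S ^ k + var_comb (\<lambda>v. S ^ Suc (k + v))"
    by (simp only: distrib_right mult_1 var_comb_mult_right power_add [symmetric] add_Suc
        add_Suc_right add.commute)
  finally show "S ^ Suc k = S ^ k + var_comb (\<lambda>v. S ^ Suc (k + v))"
    by (simp only: power_Suc)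
qed

section \<open>Paths from a given height with a given monomial\<close>

definition step_vars :: "int list \<Rightarrow> nat multiset" where
  "step_vars P = mset (map nat (filter (\<lambda>s. 0 \<le> s) P))"

text \<open>The weight is a single monomial: a step -1 has weight 1, and a step
  \<open>s \<ge> 0\<close> has weight \<open>t (s + 1)\<close>, the variable with index
  \<open>s\<close>.\<close>

lemma coeff_path_weight:
  "set P \<subseteq> {-1..} \<Longrightarrow>
     coeff (path_weight P :: (nat, 'a :: comm_ring_1) mfps) m = (if step_vars P = m then 1 else 0)"
proof (induction P arbitrary: m)
  case Nil
  then show ?case by (auto simp: path_weight_def step_vars_def coeff_one)
next
  case (Cons s P)
  have "path_weight (s # P) = step_weight s * (path_weight P :: (nat, 'a) mfps)"
    by (simp add: path_weight_def)
  moreover have "s = -1 \<or> 0 \<le> s" using Cons.prems by auto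
  ultimately show ?case
    using Cons by (auto simp: step_weight_def step_vars_def t_def coeff_var_mult)
qed

definition paths_from :: "nat \<Rightarrow> int list set" where
  "paths_from k = {P. set P \<subseteq> {-1..} \<and> (\<forall>i \<le> length P. 0 \<le> int k + sum_list (take i P)) \<and>
     int k + sum_list P = 0}"

lemma paths_from_0: "paths_from 0 = excursions"
  by (simp add: paths_from_def excursions_def)

lemma Nil_in_paths_from_iff: "[] \<in> paths_from k \<longleftrightarrow> k = 0"
  by (simp add: paths_from_def)

lemma Cons_in_paths_from_iff:
  "s # P \<in> paths_from k \<longleftrightarrow> -1 \<le> s \<and> 0 \<le> int k + s \<and> P \<in> paths_from (nat (int k + s))"
proof -
  have "(\<forall>i \<le> length (s # P). 0 \<le> int k + sum_list (take i (s # P))) \<longleftrightarrow>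
      (\<forall>i \<le> length P. 0 \<le> int k + s + sum_list (take i P))"
    by (simp add: All_less_Suc2 add.assoc flip: less_Suc_eq_le)
  \<comment> \<open>The tail condition at \<open>i = 0\<close> is the condition on the height after
    the first step, so \<open>nat\<close> does not truncate that height.\<close>
  moreover have "0 \<le> int k + s" if "\<forall>i \<le> length P. 0 \<le> int k + s + sum_list (take i P)"
    using that [rule_format, of 0] by simp
  ultimately show ?thesis
    by (auto simp: paths_from_def add.assoc)
qed

definition paths_with_vars :: "nat \<Rightarrow> nat multiset \<Rightarrow> int list set" where
  "paths_with_vars k m = {P \<in> paths_from k. step_vars P = m}"

text \<open>The part of the decomposition by first step that uses no variable. At height 0 a step -1
  is forbidden, and the empty path takes its place; it accounts for the initial value 1 of the
  recursion.\<close>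

definition down_paths :: "nat \<Rightarrow> nat multiset \<Rightarrow> int list set" where
  "down_paths k m = (case k of 0 \<Rightarrow> if m = {#} then {[]} else {}
     | Suc j \<Rightarrow> (#) (-1) ` paths_with_vars j m)"

text \<open>Case distinction on the first step: a step \<open>v \<ge> 0\<close> uses up one copy of
  the variable \<open>v\<close> and leads to height \<open>k + v\<close>.\<close>

lemma paths_with_vars_eq:
  "paths_with_vars k m =
     down_paths k m \<union> (\<Union>v \<in> set_mset m. (#) (int v) ` paths_with_vars (k + v) (m - {#v#}))"
  (is "?L = ?R")
proof (rule set_eqI)
  fix P
  show "P \<in> ?L \<longleftrightarrow> P \<in> ?R"
  proof (cases P)
    case Nil
    then show ?thesis
      by (auto simp: paths_with_vars_def down_paths_def Nil_in_paths_from_iff step_vars_def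
          split: nat.splits)
  next
    case (Cons s Q)
    consider "s = -1" | v where "s = int v" | "s < -1"
      by (metis add.left_inverse linorder_cases linorder_not_less nonneg_int_cases zle_add1_eq_le)
    then show ?thesis
    proof cases
      case 1
      with Cons show ?thesis
        by (auto simp: paths_with_vars_def down_paths_def Cons_in_paths_from_iff step_vars_def
            split: nat.splits)
    next
      case 2
      with Cons show ?thesis
        by (auto simp: paths_with_vars_def down_paths_def Cons_in_paths_from_iff step_vars_def
            nat_int_add split: nat.splits)
    next
      case 3
      with Cons show ?thesis
        by (auto simp: paths_with_vars_def down_paths_def Cons_in_paths_from_iff
            split: nat.splits)
    qed
  qed
qed

text \<open>After the first step either the monomial has smaller degree, or it is unchanged and the
  height is smaller.\<close>

lemma finite_paths_with_vars: "finite (paths_with_vars k m)"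
proof (induction "size m" arbitrary: m k rule: less_induct)
  case less
  note smaller = less
  show ?case
  proof (induction k)
    case 0
    show ?case
      by (subst paths_with_vars_eq) (auto simp: down_paths_def smaller size_Diff1_less)
  next
    case (Suc k)
    then show ?case
      by (subst paths_with_vars_eq) (auto simp: down_paths_def smaller size_Diff1_less)
  qed
qed

lemma finite_down_paths: "finite (down_paths k m)"
  by (simp add: down_paths_def finite_paths_with_vars split: nat.split)

lemma card_paths_with_vars:
  "card (paths_with_vars k m) =
     card (down_paths k m) + (\<Sum>v \<in> set_mset m. card (paths_with_vars (k + v) (m - {#v#})))"
proof -
  let ?up = "\<lambda>v. (#) (int v) ` paths_with_vars (k + v) (m - {#v#})"
  have "card (paths_with_vars k m) = card (down_paths k m) + card (\<Union>v \<in> set_mset m. ?up v)"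
    \<comment> \<open>The pieces are disjoint because their paths have different heads or are
      empty.\<close>
    by (subst paths_with_vars_eq, rule card_Un_disjoint)
       (auto simp: finite_down_paths finite_paths_with_vars down_paths_def split: nat.splits if_splits)
  also have "card (\<Union>v \<in> set_mset m. ?up v) = (\<Sum>v \<in> set_mset m. card (?up v))"
    by (rule card_UN_disjoint) (auto simp: finite_paths_with_vars)
  also have "\<dots> = (\<Sum>v \<in> set_mset m. card (paths_with_vars (k + v) (m - {#v#})))"
    by (simp add: card_image)
  finally show ?thesis .
qed

section \<open>Generating functions of paths and the conclusion\<close>

text \<open>Index shift: \<open>path_gf (Suc k)\<close> belongs to starting height \<open>k\<close>.\<close>

definition path_gf :: "nat \<Rightarrow> (nat, 'a :: comm_ring_1) mfps" where
  "path_gf n = (case n of 0 \<Rightarrow> 1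
     | Suc k \<Rightarrow> Abs_mfps (\<lambda>m. of_nat (card (paths_with_vars k m))))"

lemma first_step_rec_path_gf: "first_step_rec path_gf"
  unfolding first_step_rec_def
proof (intro allI mfps_eqI)
  fix k m
  \<comment> \<open>With the index shift, a step -1 from height \<open>k = Suc j\<close> leads to
    height \<open>j\<close>, whose series has index \<open>k\<close>; for \<open>k = 0\<close> the
    empty path gives the series 1.\<close>
  have "of_nat (card (down_paths k m)) = coeff (path_gf k :: (nat, 'a) mfps) m"
    by (simp add: down_paths_def path_gf_def coeff_one card_image split: nat.split)
  then show "coeff (path_gf (Suc k) :: (nat, 'a) mfps) m =
      coeff (path_gf k + var_comb (\<lambda>v. path_gf (Suc (k + v)))) m"
    by (simp add: path_gf_def coeff_var_comb card_paths_with_vars [of k])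
qed

lemma
  shows mfps_summable_excursions:
      "mfps_summable (path_weight :: _ \<Rightarrow> (nat, 'a :: comm_ring_1) mfps) excursions" (is ?summable)
    and mfps_sum_excursions: "mfps_sum path_weight excursions = (path_gf 1 :: (nat, 'a) mfps)" (is ?sum)
proof -
  have weight: "coeff (path_weight P :: (nat, 'a) mfps) m = (if step_vars P = m then 1 else 0)"
    if "P \<in> excursions" for P m
    using that by (simp add: excursions_def coeff_path_weight)
  \<comment> \<open>The excursions whose weight contains \<open>m\<close> form the finite set
    \<open>paths_with_vars 0 m\<close>, and each contributes 1 to the coefficient.\<close>
  then have supp: "{P \<in> excursions. coeff (path_weight P :: (nat, 'a) mfps) m \<noteq> 0} =
      paths_with_vars 0 m" for m
    by (auto simp: paths_with_vars_def paths_from_0 split: if_splits)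
  show ?summable
    by (simp add: mfps_summable_def supp finite_paths_with_vars)
  show ?sum
  proof (rule mfps_eqI)
    fix m
    have "coeff (mfps_sum path_weight excursions :: (nat, 'a) mfps) m =
        (\<Sum>P \<in> paths_with_vars 0 m. coeff (path_weight P) m)"
      by (simp add: mfps_sum_def supp)
    also have "\<dots> = (\<Sum>P \<in> paths_with_vars 0 m. 1)"
      by (rule sum.cong) (auto simp: weight paths_with_vars_def paths_from_0)
    also have "\<dots> = coeff (path_gf 1) m"
      by (simp add: path_gf_def)
    finally show "coeff (mfps_sum path_weight excursions :: (nat, 'a) mfps) m = coeff (path_gf 1) m" .
  qed
qed

theorem theorem3p3:
  shows "(\<exists>!S :: (nat, 'a :: comm_ring_1) mfps. tree_equation S) \<and>
    (\<forall>S :: (nat, 'a) mfps. tree_equation S \<longrightarrow>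
       mfps_summable (path_weight :: int list \<Rightarrow> (nat, 'a) mfps) excursions \<and>
       S = mfps_sum path_weight excursions)"
proof -
  have gf_0: "path_gf 0 = (1 :: (nat, 'a) mfps)"
    by (simp add: path_gf_def)
  have "S = path_gf 1" if "tree_equation S" for S :: "(nat, 'a) mfps"
    \<comment> \<open>The powers of \<open>S\<close> and \<open>path_gf\<close> both start with 1;
      at index 1 the power is \<open>S\<close> itself.\<close>
    using first_step_rec_unique [OF first_step_rec_powers [OF that] first_step_rec_path_gf, of 1]
    by (simp add: gf_0)
  moreover have "tree_equation (path_gf 1 :: (nat, 'a) mfps)"
    by (rule tree_equation_first_step_rec [OF first_step_rec_path_gf gf_0])
  ultimately show ?thesis
    by (metis mfps_summable_excursions mfps_sum_excursions)
qed

end
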